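(* Let $f:[0,1]\to\mathbb{R}$, let $N\ge1$ and $K\ge2$ be integers, let $\mathcal{S}_1,\dots,\mathcal{S}_{K}$ be a nested family of collections of multi-indices with $\mathcal{S}_K=\emptyset$, and let $S=A_1A_2\cdots A_K$ be the quantized tensor train produced by the multiresolution construction (all as described in the context). Then $S$ admits the following interpretation. For fixed $\sigma_{1:K}\in\{0,1\}^K$, consider the smallest $k\in\{1,\dots,K\}$ such that $\sigma_{1:k}\notin\mathcal{S}_k$. If $k\le K-1$, then $$S(\sigma_{1:K})=\sum_{\alpha=0}^N f(x_{\le k}+2^{-k}c^\alpha)\,P^\alpha(2^kx_{>k}),$$ where $x_{\le k}=\sum_{l=1}^k2^{-l}\sigma_l$ and $x_{>k}=\sum_{l=k+1}^K2^{-l}\sigma_l$; that is, $S(\sigma_{1:K})$ is the value at $x_{\le K}$ of the interpolation of $f$ on the Chebyshev-Lobatto grid shifted and scaled to $[x_{\le k},x_{\le k}+2^{-k}]$. If $k=K$, then $S(\sigma_{1:K})=f(x_{\le K})$, where $x_{\le K}=\sum_{l=1}^K 2^{-l}\sigma_l$. Letting $T$ denote the exact quantized tensor representation of $f$ on $\mathcal{D}_K$, it follows that $$\|S-T\|_\infty\le\max\left\{E_{I,N}[f]\ :\ I\notin\bigcup_{k=1}^{K-1}\mathcal{S}_k\ \text{is a dyadic subinterval of }[0,1]\text{ of length at least }2^{-(K-1)}\right\},$$ where the dyadic subintervals are the intervals of the form $[x,x+2^{-k}]$ with $x\in\mathcal{D}_k$ and $k\in\{1,\dots,K-1\}$, a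 multi-index $\sigma_{1:k}\in\mathcal{S}_k$ is identified with the interval $\left[\sum_{l=1}^k2^{-l}\sigma_l,\ \sum_{l=1}^k2^{-l}\sigma_l+2^{-k}\right]$, and $E_{I,N}[f]$ denotes the $L^\infty$-norm error on $I$ of $(N+1)$-point Chebyshev-Lobatto interpolation of $f$ on the interval $I$.
   Context: Notation: $\sigma_{1:k}=(\sigma_1,\dots,\sigma_k)\in\{0,1\}^k$. $\mathcal{D}_k=(2^{-k}\mathbb{Z})\cap[0,1)$. The quantized tensor representation of $f$ on $\mathcal{D}_K$ is $T:\{0,1\}^K\to\mathbb{R}$, $T(\sigma_{1:K})=f\left(\sum_{l=1}^K2^{-l}\sigma_l\right)$. $\|S\|_\infty=\max_{\sigma\in\{0,1\}^K}|S(\sigma)|$. Chebyshev-Lobatto grid on $[0,1]$: $c^\alpha=\frac{\cos(\pi\alpha/N)+1}{2}$, $\alpha=0,\dots,N$; $P^\alpha$ is the Lagrange basis polynomial of degree $N$ with $P^\alpha(c^\beta)=\delta^{\alpha\beta}$. For $I=[x,x+2^{-k}]$, $E_{I,N}[f]=\sup_{v\in[0,1]}\left|f(x+2^{-k}v)-\sum_{\alpha=0}^Nf(x+2^{-k}c^\alpha)P^\alpha(v)\right|$ (possibly $+\infty$). The maximum over an empty set is $0$. Nested family: for each $k<K$, $\mathcal{S}_k=\{\sigma_{1:k}^i:i=1,\dots,q_k\}\subset\{0,1\}^k$ is a given collection of (distinct) multi-indices ("dangerous" subintervals), and $\mathcal{S}_K=\emptyset$. It is assumed that every element of $\mathcal{S}_{k+1}$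 can be written as $(\sigma_{1:k}^j,\sigma)$ for some $\sigma_{1:k}^j\in\mathcal{S}_k$ and $\sigma\in\{0,1\}$. Put $x_{\le k}^i=\sum_{l=1}^k2^{-l}\sigma_l^i$. Multiresolution construction. Let $A^{\alpha\beta}(\sigma)=P^\alpha\left(\frac{\sigma+c^\beta}{2}\right)$ and $A_R^{\alpha,1}(\sigma)=P^\alpha\left(\frac{\sigma}{2}\right)$ for $\alpha,\beta\in\{0,\dots,N\}$, $\sigma\in\{0,1\}$. First core: $A_1(\sigma)$ is the row vector of length $N+1+q_1$ whose first $N+1$ entries are $f\left(\frac{\sigma+c^\beta}{2}\right)$, $\beta=0,\dots,N$, if $(\sigma)\notin\mathcal{S}_1$ and $0$ otherwise, and whose last $q_1$ entries are, for $i=1,\dots,q_1$, $1$ if $(\sigma)=\sigma_{1:1}^i$ and $0$ otherwise. Middle cores, $k=2,\dots,K-1$: $A_k(\sigma)=\begin{pmatrix}A(\sigma)&0\\ F_k(\sigma)&\chi_k(\sigma)\end{pmatrix}$, of size $(N+1+q_{k-1})\times(N+1+q_k)$, where $F_k^{i\beta}(\sigma)=0$ if $(\sigma_{1:k-1}^i,\sigma)\in\mathcal{S}_k$ and $F_k^{i\beta}(\sigma)=f(x_{\le k-1}^i+2^{-k}\sigma+2^{-k}c^\beta)$ otherwise; and $\chi_k^{ij}(\sigma)=1$ if $\sigma_{1:k}^j=(\sigma_{1:k-1}^i,\sigma)$ and $0$ otherwise. Last core: $A_K(\sigma)=\begin{pmatrix}A_R(\sigma)\\ F_K(\sigma)\end{pmatrix}$,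 where $F_K^{i,1}(\sigma)=f(x_{\le K-1}^i+2^{-K}\sigma)$, $i=1,\dots,q_{K-1}$. The tensor $S$ is the matrix product $S(\sigma_{1:K})=A_1(\sigma_1)A_2(\sigma_2)\cdots A_K(\sigma_K)$. *)

theory Defs
  imports
    Complex_Main
    "HOL-Library.Extended_Real"
    "HOL-Computational_Algebra.Polynomial"
    "Jordan_Normal_Form.Matrix"
begin

text \<open>
  Conventions. A multi-index in \<open>{0,1}^k\<close> is a \<open>nat list\<close> of length \<open>k\<close> with entries in
  \<open>{0,1}\<close>; the entry \<open>\<sigma>\<^sub>l\<close> is \<open>s ! (l - 1)\<close> and the prefix \<open>\<sigma>\<^bsub>1:k\<^esub>\<close> is \<open>take k s\<close>.
  A function \<open>f\<close> on \<open>[0,1]\<close> is a function \<open>real \<Rightarrow> real\<close> of which only the values on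
  \<open>[0,1]\<close> enter any of the definitions.
\<close>

definition multi_indices :: "nat \<Rightarrow> nat list set" where
  "multi_indices k = {s. set s \<subseteq> {0, 1} \<and> length s = k}"

definition dyadic_value :: "nat list \<Rightarrow> real" where
  "dyadic_value s = (\<Sum>l = 1..length s. real (s ! (l - 1)) / 2 ^ l)"

definition dyadic_grid :: "nat \<Rightarrow> real set" where
  "dyadic_grid k = range (\<lambda>z::int. of_int z / 2 ^ k) \<inter> {0..<1}"

definition dyadic_interval :: "nat list \<Rightarrow> real set" where
  "dyadic_interval s = {dyadic_value s .. dyadic_value s + 1 / 2 ^ length s}"

definition qtensor :: "(real \<Rightarrow> real) \<Rightarrow> nat list \<Rightarrow> real" where
  "qtensor f s = f (dyadic_value s)"

definition tensor_norm :: "nat \<Rightarrow> (nat list \<Rightarrow> real) \<Rightarrow> real" where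
  "tensor_norm K S = Max ((\<lambda>s. \<bar>S s\<bar>) ` multi_indices K)"


subsection \<open>Chebyshev-Lobatto interpolation\<close>

definition cl_node :: "nat \<Rightarrow> nat \<Rightarrow> real" where
  "cl_node N a = (cos (pi * real a / real N) + 1) / 2"

definition cl_basis :: "nat \<Rightarrow> nat \<Rightarrow> real poly" where
  "cl_basis N a =
     (\<Prod>b \<in> {0..N} - {a}.
        Polynomial.smult (1 / (cl_node N a - cl_node N b)) [:- cl_node N b, 1:])"

text \<open>The interpolating polynomial of \<open>f\<close> on the grid moved to \<open>[x, x + 2^(-k)]\<close>.\<close>

definition cl_interpolant :: "(real \<Rightarrow> real) \<Rightarrow> nat \<Rightarrow> real \<Rightarrow> nat \<Rightarrow> real poly" where
  "cl_interpolant f N x k =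
     (THE p. degree p \<le> N \<and>
        (\<forall>a\<in>{0..N}. poly p (x + cl_node N a / 2 ^ k) = f (x + cl_node N a / 2 ^ k)))"

text \<open>The error on \<open>I = [x, x + 2^(-k)]\<close>; it is infinite if \<open>f\<close> is unbounded on \<open>I\<close>.\<close>

definition cl_error :: "(real \<Rightarrow> real) \<Rightarrow> nat \<Rightarrow> real \<Rightarrow> nat \<Rightarrow> ereal" where
  "cl_error f N x k =
     (SUP v\<in>{0..1::real}.
        ereal \<bar>f (x + v / 2 ^ k)
               - (\<Sum>a = 0..N. f (x + cl_node N a / 2 ^ k) * poly (cl_basis N a) v)\<bar>)"

definition max_or_zero :: "ereal set \<Rightarrow> ereal" where
  "max_or_zero X = (if X = {} then 0 else Max X)"


subsection \<open>Nested families of dangerous subintervals\<close>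

text \<open>
  \<open>\<S> k\<close> lists the elements of the \<open>k\<close>-th collection without repetition, so \<open>q\<^sub>k\<close> is
  \<open>length (\<S> k)\<close> and the \<open>i\<close>-th multi-index is \<open>\<S> k ! (i - 1)\<close>. The value \<open>\<S> 0\<close> is irrelevant.
\<close>

definition nested_family :: "nat \<Rightarrow> (nat \<Rightarrow> nat list list) \<Rightarrow> bool" where
  "nested_family K \<S> \<longleftrightarrow>
     (\<forall>k\<in>{1..K}. distinct (\<S> k) \<and> set (\<S> k) \<subseteq> multi_indices k) \<and>
     (\<forall>k\<in>{1..<K}. \<forall>t\<in>set (\<S> (k + 1)). \<exists>s\<in>set (\<S> k). \<exists>b\<in>{0, 1}. t = s @ [b]) \<and>
     \<S> K = []"

definition safe_level :: "nat \<Rightarrow> (nat \<Rightarrow> nat list list) \<Rightarrow> nat list \<Rightarrow> nat" where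
  "safe_level K \<S> s = (LEAST k. k \<in> {1..K} \<and> take k s \<notin> set (\<S> k))"


subsection \<open>The multiresolution construction\<close>

text \<open>
  Rows and columns are numbered from \<open>0\<close>, so the entries belonging to the dangerous
  subintervals have the numbers \<open>N + 1, \<dots>, N + q\<^sub>k\<close>.
\<close>

definition block_A :: "nat \<Rightarrow> nat \<Rightarrow> real mat" where
  "block_A N \<sigma> =
     mat (N + 1) (N + 1) (\<lambda>(a, b). poly (cl_basis N a) ((real \<sigma> + cl_node N b) / 2))"

definition block_AR :: "nat \<Rightarrow> nat \<Rightarrow> real mat" where
  "block_AR N \<sigma> = mat (N + 1) 1 (\<lambda>(a, _). poly (cl_basis N a) (real \<sigma> / 2))"

definition block_F ::
  "(real \<Rightarrow> real) \<Rightarrow> nat \<Rightarrow> (nat \<Rightarrow> nat list list) \<Rightarrow> nat \<Rightarrow> nat \<Rightarrow> real mat" where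
  "block_F f N \<S> k \<sigma> =
     mat (length (\<S> (k - 1))) (N + 1)
       (\<lambda>(i, b). if \<S> (k - 1) ! i @ [\<sigma>] \<in> set (\<S> k) then 0
                 else f (dyadic_value (\<S> (k - 1) ! i) + real \<sigma> / 2 ^ k + cl_node N b / 2 ^ k))"

definition block_chi :: "(nat \<Rightarrow> nat list list) \<Rightarrow> nat \<Rightarrow> nat \<Rightarrow> real mat" where
  "block_chi \<S> k \<sigma> =
     mat (length (\<S> (k - 1))) (length (\<S> k))
       (\<lambda>(i, j). if \<S> k ! j = \<S> (k - 1) ! i @ [\<sigma>] then 1 else 0)"

definition block_FK ::
  "(real \<Rightarrow> real) \<Rightarrow> (nat \<Rightarrow> nat list list) \<Rightarrow> nat \<Rightarrow> nat \<Rightarrow> real mat" where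
  "block_FK f \<S> K \<sigma> =
     mat (length (\<S> (K - 1))) 1 (\<lambda>(i, _). f (dyadic_value (\<S> (K - 1) ! i) + real \<sigma> / 2 ^ K))"

definition first_core ::
  "(real \<Rightarrow> real) \<Rightarrow> nat \<Rightarrow> (nat \<Rightarrow> nat list list) \<Rightarrow> nat \<Rightarrow> real mat" where
  "first_core f N \<S> \<sigma> =
     mat 1 (N + 1 + length (\<S> 1))
       (\<lambda>(_, j). if j < N + 1
                 then (if [\<sigma>] \<notin> set (\<S> 1) then f ((real \<sigma> + cl_node N j) / 2) else 0)
                 else (if [\<sigma>] = \<S> 1 ! (j - (N + 1)) then 1 else 0))"

definition middle_core ::
  "(real \<Rightarrow> real) \<Rightarrow> nat \<Rightarrow> (nat \<Rightarrow> nat list list) \<Rightarrow> nat \<Rightarrow> nat \<Rightarrow> real mat" where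
  "middle_core f N \<S> k \<sigma> =
     four_block_mat (block_A N \<sigma>)       (0\<^sub>m (N + 1) (length (\<S> k)))
                    (block_F f N \<S> k \<sigma>) (block_chi \<S> k \<sigma>)"

definition last_core ::
  "(real \<Rightarrow> real) \<Rightarrow> nat \<Rightarrow> (nat \<Rightarrow> nat list list) \<Rightarrow> nat \<Rightarrow> nat \<Rightarrow> real mat" where
  "last_core f N \<S> K \<sigma> = block_AR N \<sigma> @\<^sub>r block_FK f \<S> K \<sigma>"

definition core ::
  "(real \<Rightarrow> real) \<Rightarrow> nat \<Rightarrow> nat \<Rightarrow> (nat \<Rightarrow> nat list list) \<Rightarrow> nat \<Rightarrow> nat \<Rightarrow> real mat" where
  "core f N K \<S> k \<sigma> =
     (if k = 1 then first_core f N \<S> \<sigma>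
      else if k < K then middle_core f N \<S> k \<sigma>
      else last_core f N \<S> K \<sigma>)"

text \<open>The product of the cores is a \<open>1 \<times> 1\<close> matrix, identified with its entry.\<close>

definition multires_qtt ::
  "(real \<Rightarrow> real) \<Rightarrow> nat \<Rightarrow> nat \<Rightarrow> (nat \<Rightarrow> nat list list) \<Rightarrow> nat list \<Rightarrow> real" where
  "multires_qtt f N K \<S> s =
     foldl (*) (core f N K \<S> 1 (s ! 0)) (map (\<lambda>k. core f N K \<S> k (s ! (k - 1))) [2..<K + 1])
       $$ (0, 0)"


subsection \<open>Sanity checks\<close>

lemma cl_node_inj:
  assumes "a \<le> N" "b \<le> N" "cl_node N a = cl_node N b" "1 \<le> N"
  shows "a = b"
proof -
  have "pi * real a / real N = pi * real b / real N"
  proof (rule cos_inj_pi)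
    show "cos (pi * real a / real N) = cos (pi * real b / real N)"
      using assms by (simp add: cl_node_def)
  qed (use assms in \<open>auto simp: field_simps\<close>)
  then show ?thesis using assms by simp
qed

lemma cl_basis_node:
  assumes "a \<le> N" "b \<le> N" "1 \<le> N"
  shows "poly (cl_basis N a) (cl_node N b) = (if a = b then 1 else 0)"
proof (cases "a = b")
  case True
  have "poly (Polynomial.smult (1 / (cl_node N a - cl_node N c)) [:- cl_node N c, 1:])
      (cl_node N a) = 1" if "c \<in> {0..N} - {a}" for c
  proof -
    have "cl_node N a - cl_node N c \<noteq> 0"
      using that assms cl_node_inj[of a N c] by auto
    then show ?thesis by (simp add: divide_simps)
  qed
  then show ?thesis
    using True unfolding cl_basis_def poly_prod by (simp add: prod.neutral del: poly_smult)
next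
  case False
  then show ?thesis
    using assms by (auto simp: cl_basis_def poly_prod intro!: prod_zero bexI[of _ b])
qed

lemma degree_cl_basis:
  assumes "a \<le> N" "1 \<le> N"
  shows "degree (cl_basis N a) = N"
proof -
  have nz: "1 / (cl_node N a - cl_node N c) \<noteq> 0" if "c \<in> {0..N} - {a}" for c
    using that assms cl_node_inj[of a N c] by auto
  have "degree (cl_basis N a) =
      (\<Sum>c \<in> {0..N} - {a}.
         degree (Polynomial.smult (1 / (cl_node N a - cl_node N c)) [:- cl_node N c, 1:]))"
    unfolding cl_basis_def by (rule degree_prod_sum_eq) (use nz in auto)
  also have "\<dots> = (\<Sum>c \<in> {0..N} - {a}. 1)"
    by (rule sum.cong) (use nz in auto)
  also have "\<dots> = N" using assms by simp
  finally show ?thesis .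
qed

lemma cl_interpolant_ex1:
  assumes "1 \<le> N"
  shows "\<exists>!p::real poly. degree p \<le> N \<and>
    (\<forall>a\<in>{0..N}. poly p (x + cl_node N a / 2 ^ k) = f (x + cl_node N a / 2 ^ k))"
proof (rule ex_ex1I)
  define r where "r = [:- x * 2 ^ k, 2 ^ k:]"
  define p where
    "p = (\<Sum>a = 0..N. Polynomial.smult (f (x + cl_node N a / 2 ^ k)) (pcompose (cl_basis N a) r))"
  have "degree p \<le> N"
    unfolding p_def
    by (rule degree_sum_le)
       (use assms in \<open>auto simp: r_def degree_pcompose dest: degree_cl_basis\<close>)
  moreover have "poly p (x + cl_node N b / 2 ^ k) = f (x + cl_node N b / 2 ^ k)" if "b \<le> N" for b
  proof -
    have "poly r (x + cl_node N b / 2 ^ k) = cl_node N b"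
      by (simp add: r_def field_simps)
    then have "poly p (x + cl_node N b / 2 ^ k) =
        (\<Sum>a = 0..N. f (x + cl_node N a / 2 ^ k) * (if a = b then 1 else 0))"
      unfolding p_def poly_sum poly_smult poly_pcompose
      using that assms by (auto intro!: sum.cong simp: cl_basis_node)
    then show ?thesis using that by (simp add: if_distrib cong: if_cong)
  qed
  ultimately show "\<exists>p. degree p \<le> N \<and>
    (\<forall>a\<in>{0..N}. poly p (x + cl_node N a / 2 ^ k) = f (x + cl_node N a / 2 ^ k))"
    by auto
next
  fix p q :: "real poly"
  let ?g = "\<lambda>a. x + cl_node N a / 2 ^ k"
  assume p: "degree p \<le> N \<and> (\<forall>a\<in>{0..N}. poly p (?g a) = f (?g a))"
    and q: "degree q \<le> N \<and> (\<forall>a\<in>{0..N}. poly q (?g a) = f (?g a))"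
  have inj: "inj_on ?g {0..N}"
    by (rule inj_onI, rule cl_node_inj) (use assms in auto)
  have "card (?g ` {0..N}) = N + 1" using card_image[OF inj] by simp
  then show "p = q"
    using p q by (intro poly_eqI_degree[of "?g ` {0..N}"]) auto
qed

lemma finite_dyadic_grid: "finite (dyadic_grid k)"
proof (rule finite_subset)
  show "dyadic_grid k \<subseteq> (\<lambda>z::int. of_int z / 2 ^ k) ` {0..2 ^ k}"
  proof
    fix x assume "x \<in> dyadic_grid k"
    then obtain z :: int where z: "x = of_int z / 2 ^ k" "0 \<le> x" "x < 1"
      by (auto simp: dyadic_grid_def)
    have "\<not> (2::real) ^ k \<le> 0" by (simp add: not_le)
    then have "0 \<le> z" "(of_int z :: real) < of_int (2 ^ k)"
      using z by (simp_all add: zero_le_divide_iff)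
    then have "0 \<le> z" "z < 2 ^ k"
      by (simp_all only: of_int_less_iff)
    then show "x \<in> (\<lambda>z::int. of_int z / 2 ^ k) ` {0..2 ^ k}" using z by auto
  qed
qed simp

end

theory Submission imports Defs begin

text \<open>
  The partial products \<open>A\<^sub>1(\<sigma>\<^sub>1) \<cdots> A\<^sub>k(\<sigma>\<^sub>k)\<close>, \<open>k < K\<close>, are rows of length \<open>N + 1 + q\<^sub>k\<close>, and
  their shape is known explicitly. As long as \<open>\<sigma>\<^bsub>1:k\<^esub>\<close> is dangerous, the row is the unit vector
  that marks the position of \<open>\<sigma>\<^bsub>1:k\<^esub>\<close> in the list \<open>\<S> k\<close>: multiplication by \<open>\<chi>\<close> moves the mark to
  the child interval. At the first safe level \<open>m\<close> the mark picks the row of \<open>F\<close> that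
  contains the samples of \<open>f\<close> on the Chebyshev-Lobatto grid of the current interval (if \<open>m = 1\<close>,
  the first core supplies these samples itself), and the last
  \<open>q\<^sub>m\<close> entries vanish (lemma \<open>partial_product_up_to_safe\<close>). Let \<open>g\<close> be the polynomial of degree at
  most \<open>N\<close> that interpolates these samples. From level \<open>m\<close> on, the first \<open>N + 1\<close> entries are the
  values of \<open>g\<close>, always the same polynomial, on the grids of the successively smaller intervals:
  multiplication by \<open>A(\<sigma>)\<close> is Lagrange interpolation from a grid to the grid of one half of the
  interval, which is exact for \<open>g\<close> (lemmas \<open>lagrange_affine\<close> and \<open>partial_product_after_safe\<close>).
  The last core evaluates \<open>g\<close> at \<open>x\<^bsub>\<le>K\<^esub>\<close>, or reads off \<open>f\<close> itself if the mark is still there.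

  The error estimate is then pointwise. An index whose safe level is \<open>K\<close> contributes no error. For
  one with safe level \<open>k < K\<close> the error is one of the numbers under the supremum that defines
  \<open>cl_error f N x k\<close>, where \<open>x\<close> is the left end point of the interval of \<open>\<sigma>\<^bsub>1:k\<^esub>\<close>; this interval
  is not among the dangerous ones because an interval determines its multi-index
  (lemma \<open>dyadic_interval_inj\<close>).
\<close>

section \<open>Dyadic values and dyadic intervals\<close>

text \<open>The integer whose binary digits, most significant first, are the entries of the list.\<close>

definition binary_value :: "nat list \<Rightarrow> nat" where
  "binary_value t = foldl (\<lambda>n b. 2 * n + b) 0 t"

lemma binary_value_Nil [simp]: "binary_value [] = 0"
  by (simp add: binary_value_def)

lemma binary_value_snoc [simp]: "binary_value (t @ [b]) = 2 * binary_value t + b"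
  by (simp add: binary_value_def)

lemma binary_value_less: "set t \<subseteq> {0, 1} \<Longrightarrow> binary_value t < 2 ^ length t"
proof (induction t rule: rev_induct)
  case (snoc b t)
  then have "binary_value t < 2 ^ length t" "b \<le> 1" by auto
  then show ?case by simp
qed simp

lemma binary_value_inj:
  "\<lbrakk>set t \<subseteq> {0, 1}; set u \<subseteq> {0, 1}; length t = length u; binary_value t = binary_value u\<rbrakk>
    \<Longrightarrow> t = u"
proof (induction t arbitrary: u rule: rev_induct)
  case (snoc b t)
  then obtain c v where u: "u = v @ [c]" by (cases u rule: rev_cases) auto
  have "b \<le> 1" "c \<le> 1" using snoc.prems u by auto
  moreover have "2 * binary_value t + b = 2 * binary_value v + c"
    using snoc.prems u by simp
  ultimately have "binary_value t = binary_value v" "b = c" by presburger+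
  then show ?case using snoc u by auto
qed simp

lemma dyadic_value_Nil [simp]: "dyadic_value [] = 0"
  by (simp add: dyadic_value_def)

lemma dyadic_value_snoc:
  "dyadic_value (t @ [b]) = dyadic_value t + real b / 2 ^ (length t + 1)"
proof -
  have "(\<Sum>l = 1..length t. real ((t @ [b]) ! (l - 1)) / 2 ^ l) = dyadic_value t"
    unfolding dyadic_value_def by (rule sum.cong) (auto simp: nth_append)
  then show ?thesis by (simp add: dyadic_value_def)
qed

lemma dyadic_value_append:
  "dyadic_value (t @ u) = dyadic_value t + dyadic_value u / 2 ^ length t"
proof (induction u rule: rev_induct)
  case (snoc b u)
  have "dyadic_value (t @ u @ [b]) = dyadic_value ((t @ u) @ [b])" by simp
  also have "\<dots> = dyadic_value t + dyadic_value (u @ [b]) / 2 ^ length t"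
    by (simp only: dyadic_value_snoc snoc.IH) (simp add: field_simps power_add)
  finally show ?case .
qed simp

lemma dyadic_value_take_Suc:
  assumes "k < length s"
  shows "dyadic_value (take (Suc k) s) = dyadic_value (take k s) + real (s ! k) / 2 ^ Suc k"
  using assms by (simp add: take_Suc_conv_app_nth dyadic_value_snoc)

lemma dyadic_value_binary: "dyadic_value t = real (binary_value t) / 2 ^ length t"
  by (induction t rule: rev_induct) (simp_all add: dyadic_value_snoc field_simps)

lemma dyadic_value_bounds:
  assumes "set t \<subseteq> {0, 1}"
  shows "0 \<le> dyadic_value t" "dyadic_value t < 1"
proof -
  have "real (binary_value t) < 2 ^ length t"
    using binary_value_less[OF assms] by (metis of_nat_less_iff of_nat_numeral of_nat_power)
  then show "0 \<le> dyadic_value t" "dyadic_value t < 1"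
    by (simp_all add: dyadic_value_binary)
qed

lemma dyadic_value_in_grid:
  assumes "t \<in> multi_indices k"
  shows "dyadic_value t \<in> dyadic_grid k"
proof -
  have "set t \<subseteq> {0, 1}" "length t = k" using assms by (auto simp: multi_indices_def)
  moreover from this have "dyadic_value t = of_int (int (binary_value t)) / 2 ^ k"
    by (simp add: dyadic_value_binary)
  ultimately show ?thesis
    using dyadic_value_bounds[of t] unfolding dyadic_grid_def by fastforce
qed

lemma dyadic_interval_inj:
  assumes t: "t \<in> multi_indices k" and u: "u \<in> multi_indices j"
    and eq: "dyadic_interval t = dyadic_interval u"
  shows "k = j" "t = u"
proof -
  have len: "length t = k" "length u = j" and bits: "set t \<subseteq> {0, 1}" "set u \<subseteq> {0, 1}"
    using t u by (auto simp: multi_indices_def)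
  have "dyadic_value t \<le> dyadic_value t + 1 / 2 ^ k" by simp
  then have left: "dyadic_value t = dyadic_value u"
    and "dyadic_value t + 1 / 2 ^ k = dyadic_value u + 1 / 2 ^ j"
    using eq unfolding dyadic_interval_def len Icc_eq_Icc by auto
  then have "(2::real) ^ k = 2 ^ j" by simp
  then show "k = j" by (simp add: power_inject_exp)
  then have "binary_value t = binary_value u"
    using left len by (simp add: dyadic_value_binary)
  then show "t = u" using binary_value_inj bits len \<open>k = j\<close> by simp
qed

lemma finite_multi_indices: "finite (multi_indices k)"
  unfolding multi_indices_def by (rule finite_lists_length_eq) simp

lemma multi_indices_nonempty: "multi_indices k \<noteq> {}"
proof -
  have "replicate k 0 \<in> multi_indices k" by (auto simp: multi_indices_def)
  then show ?thesis by blast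
qed

lemma take_in_multi_indices: "\<lbrakk>s \<in> multi_indices K; k \<le> K\<rbrakk> \<Longrightarrow> take k s \<in> multi_indices k"
  by (auto simp: multi_indices_def dest: in_set_takeD)


section \<open>Exactness of Lagrange interpolation\<close>

lemma lagrange_affine:
  fixes g :: "real poly"
  assumes N: "1 \<le> N" and deg: "degree g \<le> N"
  shows "(\<Sum>a = 0..N. poly g (x + h * cl_node N a) * poly (cl_basis N a) v) = poly g (x + h * v)"
proof -
  define q where "q = pcompose g [:x, h:]"
  define p where "p = (\<Sum>a = 0..N. Polynomial.smult (poly q (cl_node N a)) (cl_basis N a))"
  have pq: "poly q y = poly g (x + h * y)" for y
    by (simp add: q_def poly_pcompose mult.commute)
  have "degree q \<le> degree g * degree [:x, h:]"
    unfolding q_def by (rule degree_pcompose_le)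
  also have "\<dots> \<le> N * 1" by (rule mult_mono) (use deg in auto)
  finally have dq: "degree q \<le> N" by simp
  have dp: "degree p \<le> N"
    unfolding p_def
    by (rule degree_sum_le) (use N in \<open>auto simp: degree_cl_basis\<close>)
  have node: "poly p (cl_node N b) = poly q (cl_node N b)" if "b \<le> N" for b
  proof -
    have "poly p (cl_node N b) = (\<Sum>a = 0..N. poly q (cl_node N a) * (if a = b then 1 else 0))"
      unfolding p_def poly_sum poly_smult
      by (rule sum.cong) (use that N in \<open>auto simp: cl_basis_node\<close>)
    then show ?thesis using that by (simp add: if_distrib cong: if_cong)
  qed
  have inj: "inj_on (cl_node N) {0..N}"
    by (rule inj_onI, rule cl_node_inj) (use N in auto)
  have "p = q"
    by (rule poly_eqI_degree[of "cl_node N ` {0..N}"])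
       (use node dp dq card_image[OF inj] in auto)
  then have "poly p v = poly q v" by simp
  then show ?thesis by (simp add: p_def poly_sum pq)
qed

lemma cl_interpolant_props:
  assumes "1 \<le> N"
  shows "degree (cl_interpolant f N x k) \<le> N"
    and "a \<le> N \<Longrightarrow>
      poly (cl_interpolant f N x k) (x + cl_node N a / 2 ^ k) = f (x + cl_node N a / 2 ^ k)"
  using theI'[OF cl_interpolant_ex1[OF assms, of x k f], folded cl_interpolant_def] by auto

lemma cl_interpolant_lagrange:
  assumes "1 \<le> N"
  shows "poly (cl_interpolant f N x k) (x + v / 2 ^ k) =
    (\<Sum>a = 0..N. f (x + cl_node N a / 2 ^ k) * poly (cl_basis N a) v)"
proof -
  let ?g = "cl_interpolant f N x k"
  have "(\<Sum>a = 0..N. f (x + cl_node N a / 2 ^ k) * poly (cl_basis N a) v) =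
      (\<Sum>a = 0..N. poly ?g (x + 1 / 2 ^ k * cl_node N a) * poly (cl_basis N a) v)"
    by (rule sum.cong) (use cl_interpolant_props(2)[OF assms] in auto)
  also have "\<dots> = poly ?g (x + 1 / 2 ^ k * v)"
    by (rule lagrange_affine[OF assms cl_interpolant_props(1)[OF assms]])
  finally show ?thesis by simp
qed


section \<open>Block rows and products of cores\<close>

text \<open>The row of length \<open>n + q\<close> with blocks \<open>u 0, \<dots>, u (n - 1)\<close> and \<open>w 0, \<dots>, w (q - 1)\<close>.\<close>

definition block_row :: "nat \<Rightarrow> nat \<Rightarrow> (nat \<Rightarrow> real) \<Rightarrow> (nat \<Rightarrow> real) \<Rightarrow> real mat" where
  "block_row n q u w = mat 1 (n + q) (\<lambda>(_, j). if j < n then u j else w (j - n))"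

lemma block_row_cong:
  "\<lbrakk>\<And>j. j < n \<Longrightarrow> u j = u' j; \<And>j. j < q \<Longrightarrow> w j = w' j\<rbrakk>
    \<Longrightarrow> block_row n q u w = block_row n q u' w'"
  unfolding block_row_def by (rule eq_matI) auto

lemma sum_split_blocks:
  fixes h :: "nat \<Rightarrow> real"
  shows "(\<Sum>i = 0..<n + q. h i) = (\<Sum>i = 0..<n. h i) + (\<Sum>i = 0..<q. h (n + i))"
proof -
  have "(\<Sum>i = 0..<n + q. h i) = (\<Sum>i = 0..<n. h i) + (\<Sum>i = n..<n + q. h i)"
    by (rule sum.atLeastLessThan_concat[symmetric]) auto
  also have "(\<Sum>i = n..<n + q. h i) = (\<Sum>i = 0..<q. h (n + i))"
    using sum.shift_bounds_nat_ivl[of h 0 n q] by (simp add: add.commute)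
  finally show ?thesis .
qed

lemma block_row_mult_entry:
  assumes "M \<in> carrier_mat (n + q) c" "j < c"
  shows "(block_row n q u w * M) $$ (0, j) =
    (\<Sum>i = 0..<n. u i * M $$ (i, j)) + (\<Sum>i = 0..<q. w i * M $$ (n + i, j))"
proof -
  have "(block_row n q u w * M) $$ (0, j) =
      (\<Sum>i = 0..<n + q. block_row n q u w $$ (0, i) * M $$ (i, j))"
    using assms by (simp add: block_row_def scalar_prod_def)
  also have "\<dots> = (\<Sum>i = 0..<n. u i * M $$ (i, j)) + (\<Sum>i = 0..<q. w i * M $$ (n + i, j))"
    unfolding sum_split_blocks by (simp add: block_row_def)
  finally show ?thesis .
qed

lemma block_row_mult_four_block:
  assumes "A \<in> carrier_mat n n'" "B \<in> carrier_mat n q'"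
    "C \<in> carrier_mat q n'" "D \<in> carrier_mat q q'"
  shows "block_row n q u w * four_block_mat A B C D =
    block_row n' q'
      (\<lambda>j. (\<Sum>i = 0..<n. u i * A $$ (i, j)) + (\<Sum>i = 0..<q. w i * C $$ (i, j)))
      (\<lambda>j. (\<Sum>i = 0..<n. u i * B $$ (i, j)) + (\<Sum>i = 0..<q. w i * D $$ (i, j)))"
    (is "?L = ?R")
proof (rule eq_matI)
  have M: "four_block_mat A B C D \<in> carrier_mat (n + q) (n' + q')"
    using assms by (intro four_block_carrier_mat)
  fix i j assume "i < dim_row ?R" "j < dim_col ?R"
  then have ij: "i = 0" "j < n' + q'" by (auto simp: block_row_def)
  show "?L $$ (i, j) = ?R $$ (i, j)"
    unfolding ij(1) block_row_mult_entry[OF M ij(2)]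
    using assms ij(2) by (auto simp: block_row_def intro!: arg_cong2[where f = "(+)"] sum.cong)
next
  show "dim_row ?L = dim_row ?R" "dim_col ?L = dim_col ?R"
    using assms by (auto simp: block_row_def)
qed

text \<open>A row with the mark of \<open>t\<close> in a list without repetitions selects the entry that belongs to \<open>t\<close>.\<close>

lemma sum_marked:
  fixes h :: "'a \<Rightarrow> real"
  assumes "distinct xs" "t \<in> set xs"
  shows "(\<Sum>i = 0..<length xs. (if xs ! i = t then 1 else 0) * h (xs ! i)) = h t"
proof -
  obtain m where m: "m < length xs" "xs ! m = t" using assms(2) by (auto simp: in_set_conv_nth)
  have "(\<Sum>i = 0..<length xs. (if xs ! i = t then 1 else 0) * h (xs ! i)) =
      (\<Sum>i = 0..<length xs. if i = m then h t else 0)"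
    by (rule sum.cong) (use m assms(1) in \<open>auto simp: nth_eq_iff_index_eq\<close>)
  then show ?thesis using m by simp
qed

text \<open>The product of the first \<open>k\<close> cores, for \<open>k \<ge> 1\<close>, at the digits of \<open>s\<close>.\<close>

definition partial_product ::
  "(real \<Rightarrow> real) \<Rightarrow> nat \<Rightarrow> nat \<Rightarrow> (nat \<Rightarrow> nat list list) \<Rightarrow> nat list \<Rightarrow> nat \<Rightarrow> real mat" where
  "partial_product f N K \<S> s k =
     foldl (*) (core f N K \<S> 1 (s ! 0)) (map (\<lambda>l. core f N K \<S> l (s ! (l - 1))) [2..<k + 1])"

lemma partial_product_1: "partial_product f N K \<S> s (Suc 0) = first_core f N \<S> (s ! 0)"
  by (simp add: partial_product_def core_def)

lemma partial_product_Suc: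
  assumes "1 \<le> k"
  shows "partial_product f N K \<S> s (Suc k) =
    partial_product f N K \<S> s k * core f N K \<S> (Suc k) (s ! k)"
proof -
  have "[2..<Suc k + 1] = [2..<k + 1] @ [Suc k]" using assms by simp
  then show ?thesis unfolding partial_product_def by simp
qed

lemma multires_qtt_partial_product:
  "multires_qtt f N K \<S> s = partial_product f N K \<S> s K $$ (0, 0)"
  by (simp add: multires_qtt_def partial_product_def)

text \<open>
  The row at a level \<open>k\<close> up to and including the first safe one, for the prefix \<open>t\<close> of length \<open>k\<close>:
  either the mark of \<open>t\<close> in \<open>\<S> k\<close>, or the samples of \<open>f\<close> on the grid of its interval. In the
  second case \<open>t\<close> does not occur in \<open>\<S> k\<close>, so the marking entries all vanish.
\<close>

definition marked_row ::
  "(real \<Rightarrow> real) \<Rightarrow> nat \<Rightarrow> (nat \<Rightarrow> nat list list) \<Rightarrow> nat \<Rightarrow> nat list \<Rightarrow> real mat" where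
  "marked_row f N \<S> k t =
     block_row (N + 1) (length (\<S> k))
       (\<lambda>b. if t \<in> set (\<S> k) then 0 else f (dyadic_value t + cl_node N b / 2 ^ k))
       (\<lambda>j. if \<S> k ! j = t then 1 else 0)"

text \<open>The row of the values of \<open>g\<close> on the grid of \<open>[x, x + 2^(-k)]\<close>, without any mark.\<close>

definition sample_row :: "real poly \<Rightarrow> nat \<Rightarrow> (nat \<Rightarrow> nat list list) \<Rightarrow> nat \<Rightarrow> real \<Rightarrow> real mat" where
  "sample_row g N \<S> k x =
     block_row (N + 1) (length (\<S> k)) (\<lambda>b. poly g (x + cl_node N b / 2 ^ k)) (\<lambda>_. 0)"

lemma first_core_marked: "first_core f N \<S> b = marked_row f N \<S> 1 [b]"
proof -
  have val: "dyadic_value [b] = real b / 2" using dyadic_value_snoc[of "[]" b] by simp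
  show ?thesis
    unfolding first_core_def marked_row_def block_row_def val
    by (intro eq_matI) (auto simp: add_divide_distrib)
qed

lemma block_carriers:
  "block_A N b \<in> carrier_mat (N + 1) (N + 1)"
  "block_AR N b \<in> carrier_mat (N + 1) 1"
  "block_F f N \<S> (Suc k) b \<in> carrier_mat (length (\<S> k)) (N + 1)"
  "block_chi \<S> (Suc k) b \<in> carrier_mat (length (\<S> k)) (length (\<S> (Suc k)))"
  "block_FK f \<S> (Suc k) b \<in> carrier_mat (length (\<S> k)) 1"
  by (auto simp: block_A_def block_AR_def block_F_def block_chi_def block_FK_def)

lemma last_core_carrier:
  "last_core f N \<S> (Suc k) b \<in> carrier_mat (N + 1 + length (\<S> k)) 1"
  unfolding last_core_def
  using block_carriers(2)[of N b] block_carriers(5)[of f \<S> k b] by (rule carrier_append_rows)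

lemma last_core_entry:
  "a < N + 1 \<Longrightarrow> last_core f N \<S> (Suc k) b $$ (a, 0) = poly (cl_basis N a) (real b / 2)"
  "i < length (\<S> k) \<Longrightarrow> last_core f N \<S> (Suc k) b $$ (N + 1 + i, 0) =
     f (dyadic_value (\<S> k ! i) + real b / 2 ^ Suc k)"
  unfolding last_core_def append_rows_def
  by (simp_all add: block_AR_def block_FK_def)

text \<open>
  The first \<open>N + 1\<close> entries of the row of a dangerous \<open>t\<close> are \<open>0\<close>, so only the blocks \<open>F\<close> and \<open>\<chi>\<close>
  contribute, each with the one row that the mark selects.
\<close>

lemma marked_row_middle:
  assumes t: "t \<in> set (\<S> k)" "length t = k" and dist: "distinct (\<S> k)"
  shows "marked_row f N \<S> k t * middle_core f N \<S> (Suc k) b = marked_row f N \<S> (Suc k) (t @ [b])"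
proof -
  let ?w = "\<lambda>j. if \<S> k ! j = t then 1 else (0::real)"
  have F: "(\<Sum>i = 0..<length (\<S> k). ?w i * block_F f N \<S> (Suc k) b $$ (i, c)) =
      (if t @ [b] \<in> set (\<S> (Suc k)) then 0
       else f (dyadic_value (t @ [b]) + cl_node N c / 2 ^ Suc k))" if "c < N + 1" for c
  proof -
    define h where "h r = (if r @ [b] \<in> set (\<S> (Suc k)) then 0
      else f (dyadic_value r + real b / 2 ^ Suc k + cl_node N c / 2 ^ Suc k))" for r
    have "(\<Sum>i = 0..<length (\<S> k). ?w i * block_F f N \<S> (Suc k) b $$ (i, c)) =
        (\<Sum>i = 0..<length (\<S> k). ?w i * h (\<S> k ! i))"
      by (rule sum.cong) (use that in \<open>auto simp: block_F_def h_def\<close>)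
    also have "\<dots> = h t" by (rule sum_marked[OF dist t(1)])
    finally show ?thesis using t(2) by (simp add: h_def dyadic_value_snoc)
  qed
  have chi: "(\<Sum>i = 0..<length (\<S> k). ?w i * block_chi \<S> (Suc k) b $$ (i, j)) =
      (if \<S> (Suc k) ! j = t @ [b] then 1 else 0)" if "j < length (\<S> (Suc k))" for j
  proof -
    define h where "h r = (if \<S> (Suc k) ! j = r @ [b] then 1 else 0 :: real)" for r
    have "(\<Sum>i = 0..<length (\<S> k). ?w i * block_chi \<S> (Suc k) b $$ (i, j)) =
        (\<Sum>i = 0..<length (\<S> k). ?w i * h (\<S> k ! i))"
      by (rule sum.cong) (use that in \<open>auto simp: block_chi_def h_def\<close>)
    also have "\<dots> = h t" by (rule sum_marked[OF dist t(1)])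
    finally show ?thesis by (simp add: h_def)
  qed
  show ?thesis
    unfolding marked_row_def middle_core_def
      block_row_mult_four_block[OF block_carriers(1) zero_carrier_mat block_carriers(3,4)]
    by (rule block_row_cong) (use F chi t(1) in auto)
qed

lemma sample_row_middle:
  assumes N: "1 \<le> N" and deg: "degree g \<le> N"
  shows "sample_row g N \<S> k x * middle_core f N \<S> (Suc k) b =
    sample_row g N \<S> (Suc k) (x + real b / 2 ^ Suc k)"
proof -
  have A: "(\<Sum>i = 0..<N + 1. poly g (x + cl_node N i / 2 ^ k) * block_A N b $$ (i, c)) =
      poly g (x + real b / 2 ^ Suc k + cl_node N c / 2 ^ Suc k)" if "c < N + 1" for c
  proof -
    have "(\<Sum>i = 0..<N + 1. poly g (x + cl_node N i / 2 ^ k) * block_A N b $$ (i, c)) =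
        (\<Sum>a = 0..N. poly g (x + 1 / 2 ^ k * cl_node N a) *
           poly (cl_basis N a) ((real b + cl_node N c) / 2))"
      by (rule sum.cong) (use that in \<open>auto simp: block_A_def\<close>)
    also have "\<dots> = poly g (x + 1 / 2 ^ k * ((real b + cl_node N c) / 2))"
      by (rule lagrange_affine[OF N deg])
    also have "\<dots> = poly g (x + real b / 2 ^ Suc k + cl_node N c / 2 ^ Suc k)"
      by (rule arg_cong[where f = "poly g"]) (simp add: field_simps)
    finally show ?thesis .
  qed
  show ?thesis
    unfolding sample_row_def middle_core_def
      block_row_mult_four_block[OF block_carriers(1) zero_carrier_mat block_carriers(3,4)]
    by (rule block_row_cong) (use A in auto)
qed

lemma marked_row_last:
  assumes t: "t \<in> set (\<S> k)" "length t = k" and dist: "distinct (\<S> k)"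
  shows "(marked_row f N \<S> k t * last_core f N \<S> (Suc k) b) $$ (0, 0) = f (dyadic_value (t @ [b]))"
proof -
  define h where "h r = f (dyadic_value r + real b / 2 ^ Suc k)" for r
  have "(marked_row f N \<S> k t * last_core f N \<S> (Suc k) b) $$ (0, 0) =
      (\<Sum>i = 0..<length (\<S> k). (if \<S> k ! i = t then 1 else 0) *
         last_core f N \<S> (Suc k) b $$ (N + 1 + i, 0))"
    unfolding marked_row_def block_row_mult_entry[OF last_core_carrier less_numeral_extra(1)]
    using t(1) by simp
  also have "\<dots> = (\<Sum>i = 0..<length (\<S> k). (if \<S> k ! i = t then 1 else 0) * h (\<S> k ! i))"
    by (rule sum.cong) (use last_core_entry(2)[of _ \<S> k f N b] in \<open>simp_all add: h_def\<close>)
  also have "\<dots> = h t" by (rule sum_marked[OF dist t(1)])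
  finally show ?thesis using t(2) by (simp add: h_def dyadic_value_snoc)
qed

lemma sample_row_last:
  assumes N: "1 \<le> N" and deg: "degree g \<le> N"
  shows "(sample_row g N \<S> k x * last_core f N \<S> (Suc k) b) $$ (0, 0) =
    poly g (x + real b / 2 ^ Suc k)"
proof -
  have "(sample_row g N \<S> k x * last_core f N \<S> (Suc k) b) $$ (0, 0) =
      (\<Sum>a = 0..<N + 1. poly g (x + cl_node N a / 2 ^ k) *
         last_core f N \<S> (Suc k) b $$ (a, 0))"
    unfolding sample_row_def block_row_mult_entry[OF last_core_carrier less_numeral_extra(1)] by simp
  also have "\<dots> = (\<Sum>a = 0..N. poly g (x + 1 / 2 ^ k * cl_node N a) *
         poly (cl_basis N a) (real b / 2))"
    by (rule sum.cong) (auto simp: last_core_entry)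
  also have "\<dots> = poly g (x + 1 / 2 ^ k * (real b / 2))"
    by (rule lagrange_affine[OF N deg])
  finally show ?thesis by (simp add: mult.commute)
qed


section \<open>The tensor at a fixed multi-index\<close>

lemma nested_familyD:
  assumes "nested_family K \<S>" "1 \<le> k" "k \<le> K"
  shows "distinct (\<S> k)" "set (\<S> k) \<subseteq> multi_indices k"
  using assms by (auto simp: nested_family_def)

lemma safe_level_props:
  assumes "nested_family K \<S>" "1 \<le> K"
  shows "safe_level K \<S> s \<in> {1..K}" "take (safe_level K \<S> s) s \<notin> set (\<S> (safe_level K \<S> s))"
    and "\<And>k. \<lbrakk>1 \<le> k; k < safe_level K \<S> s\<rbrakk> \<Longrightarrow> take k s \<in> set (\<S> k)"
proof -
  let ?P = "\<lambda>k. k \<in> {1..K} \<and> take k s \<notin> set (\<S> k)"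
  have "?P K" using assms by (auto simp: nested_family_def)
  then have least: "?P (safe_level K \<S> s)" unfolding safe_level_def by (rule LeastI)
  then show "safe_level K \<S> s \<in> {1..K}" "take (safe_level K \<S> s) s \<notin> set (\<S> (safe_level K \<S> s))"
    by auto
  fix k assume k: "1 \<le> k" "k < safe_level K \<S> s"
  then have "\<not> ?P k" unfolding safe_level_def by (intro not_less_Least)
  then show "take k s \<in> set (\<S> k)" using k least by auto
qed

lemma partial_product_up_to_safe:
  assumes nest: "nested_family K \<S>" and s: "s \<in> multi_indices K"
  shows "\<lbrakk>1 \<le> k; k < K; k \<le> safe_level K \<S> s\<rbrakk>
    \<Longrightarrow> partial_product f N K \<S> s k = marked_row f N \<S> k (take k s)"
proof (induction k rule: dec_induct)
  case base
  have "take (Suc 0) s = [s ! 0]"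
    using s base by (cases s) (auto simp: multi_indices_def)
  then show ?case by (simp add: partial_product_1 first_core_marked)
next
  case (step k)
  have len: "length s = K" using s by (simp add: multi_indices_def)
  have "take k s \<in> set (\<S> k)"
    by (rule safe_level_props(3)[OF nest]) (use step in auto)
  moreover have "distinct (\<S> k)" using nested_familyD(1)[OF nest] step by auto
  ultimately have "marked_row f N \<S> k (take k s) * middle_core f N \<S> (Suc k) (s ! k) =
      marked_row f N \<S> (Suc k) (take k s @ [s ! k])"
    by (intro marked_row_middle) (use len step in auto)
  then show ?case
    using step len by (simp add: partial_product_Suc core_def take_Suc_conv_app_nth)
qed

lemma partial_product_after_safe:
  fixes f :: "real \<Rightarrow> real"
  assumes N: "1 \<le> N" and nest: "nested_family K \<S>" and s: "s \<in> multi_indices K"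
    and m: "m = safe_level K \<S> s"
  defines "g \<equiv> cl_interpolant f N (dyadic_value (take m s)) m"
  shows "\<lbrakk>m \<le> k; k < K\<rbrakk>
    \<Longrightarrow> partial_product f N K \<S> s k = sample_row g N \<S> k (dyadic_value (take k s))"
proof (induction k rule: dec_induct)
  case base
  have m1: "1 \<le> m" and safe: "take m s \<notin> set (\<S> m)"
    using safe_level_props(1,2)[OF nest, of s] base m by auto
  have "partial_product f N K \<S> s m = marked_row f N \<S> m (take m s)"
    by (rule partial_product_up_to_safe[OF nest s m1 base]) (simp add: m)
  also have "\<dots> = sample_row g N \<S> m (dyadic_value (take m s))"
    unfolding marked_row_def sample_row_def g_def
  proof (rule block_row_cong)
    fix j assume "j < length (\<S> m)"
    then show "(if \<S> m ! j = take m s then 1 else 0) = (0::real)"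
      using safe nth_mem by metis
  qed (use safe cl_interpolant_props(2)[OF N] in auto)
  finally show ?case .
next
  case (step k)
  have k1: "1 \<le> k" using safe_level_props(1)[OF nest, of s] step m by auto
  have "dyadic_value (take (Suc k) s) = dyadic_value (take k s) + real (s ! k) / 2 ^ Suc k"
    by (rule dyadic_value_take_Suc) (use s step in \<open>auto simp: multi_indices_def\<close>)
  moreover have "degree g \<le> N" unfolding g_def by (rule cl_interpolant_props(1)[OF N])
  ultimately show ?case
    using step k1 sample_row_middle[OF N, of g \<S> k "dyadic_value (take k s)" f "s ! k"]
    by (simp add: partial_product_Suc core_def)
qed

lemma multires_qtt_interpolant:
  assumes N: "1 \<le> N" and nest: "nested_family K \<S>" and s: "s \<in> multi_indices K"
    and m: "m = safe_level K \<S> s" "m < K"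
  shows "multires_qtt f N K \<S> s =
    poly (cl_interpolant f N (dyadic_value (take m s)) m) (dyadic_value s)"
proof -
  have m1: "1 \<le> m" using safe_level_props(1)[OF nest, of s] m by auto
  then obtain k where k: "K = Suc k" "m \<le> k" "1 \<le> k" using m(2) by (cases K) auto
  have len: "length s = K" using s by (simp add: multi_indices_def)
  let ?g = "cl_interpolant f N (dyadic_value (take m s)) m"
  have "multires_qtt f N K \<S> s =
      (sample_row ?g N \<S> k (dyadic_value (take k s)) * last_core f N \<S> K (s ! k)) $$ (0, 0)"
    using partial_product_after_safe[OF N nest s m(1) k(2)] k
    by (simp add: multires_qtt_partial_product partial_product_Suc core_def)
  also have "\<dots> = poly ?g (dyadic_value (take k s) + real (s ! k) / 2 ^ Suc k)"
    unfolding k(1) by (rule sample_row_last[OF N cl_interpolant_props(1)[OF N]])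
  also have "dyadic_value (take k s) + real (s ! k) / 2 ^ Suc k = dyadic_value s"
    using dyadic_value_take_Suc[of k s] len k(1) by simp
  finally show ?thesis .
qed

lemma multires_qtt_exact:
  assumes K: "2 \<le> K" and nest: "nested_family K \<S>" and s: "s \<in> multi_indices K"
    and m: "safe_level K \<S> s = K"
  shows "multires_qtt f N K \<S> s = f (dyadic_value s)"
proof -
  obtain k where k: "K = Suc k" "1 \<le> k" using K by (cases K) auto
  have len: "length s = K" using s by (simp add: multi_indices_def)
  have mem: "take k s \<in> set (\<S> k)"
    by (rule safe_level_props(3)[OF nest]) (use k m in auto)
  have dist: "distinct (\<S> k)" using nested_familyD(1)[OF nest] k by auto
  have "multires_qtt f N K \<S> s =
      (marked_row f N \<S> k (take k s) * last_core f N \<S> K (s ! k)) $$ (0, 0)"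
    using partial_product_up_to_safe[OF nest s k(2)] k m
    by (simp add: multires_qtt_partial_product partial_product_Suc core_def)
  also have "\<dots> = f (dyadic_value (take k s @ [s ! k]))"
    unfolding k(1) by (rule marked_row_last[where \<S> = \<S>]) (use mem dist len k in auto)
  also have "take k s @ [s ! k] = s"
    using len k take_Suc_conv_app_nth[of k s] by simp
  finally show ?thesis .
qed

text \<open>The fine part of the position, rescaled to the unit interval, is the value of the remaining digits.\<close>

lemma dyadic_value_fine_part:
  assumes "length s = K" "k \<le> K"
  shows "2 ^ k * (\<Sum>l = k + 1..K. real (s ! (l - 1)) / 2 ^ l) = dyadic_value (drop k s)"
proof -
  let ?h = "\<lambda>l. real (s ! (l - 1)) / 2 ^ l"
  have "{1..K} = {1..k} \<union> {k + 1..K}" using assms by auto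
  then have "dyadic_value s = sum ?h {1..k} + sum ?h {k + 1..K}"
    unfolding dyadic_value_def assms(1) by (simp only:) (rule sum.union_disjoint, auto)
  also have "sum ?h {1..k} = dyadic_value (take k s)"
    unfolding dyadic_value_def using assms by (intro sum.cong) auto
  finally have "sum ?h {k + 1..K} = dyadic_value (drop k s) / 2 ^ k"
    using dyadic_value_append[of "take k s" "drop k s"] assms by simp
  then show ?thesis by simp
qed

lemma dyadic_value_split:
  assumes "k \<le> length s"
  shows "dyadic_value s = dyadic_value (take k s) + dyadic_value (drop k s) / 2 ^ k"
  using dyadic_value_append[of "take k s" "drop k s"] assms by simp

lemma cl_error_upper:
  assumes "0 \<le> v" "v \<le> 1"
  shows "ereal \<bar>f (x + v / 2 ^ k)
      - (\<Sum>a = 0..N. f (x + cl_node N a / 2 ^ k) * poly (cl_basis N a) v)\<bar> \<le> cl_error f N x k"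
  unfolding cl_error_def by (rule SUP_upper) (use assms in auto)

lemma cl_error_nonneg: "0 \<le> cl_error f N x k"
proof -
  have "(0::ereal) \<le> ereal \<bar>f (x + 0 / 2 ^ k)
      - (\<Sum>a = 0..N. f (x + cl_node N a / 2 ^ k) * poly (cl_basis N a) 0)\<bar>"
    by (simp add: zero_ereal_def)
  also have "\<dots> \<le> cl_error f N x k" by (rule cl_error_upper) auto
  finally show ?thesis .
qed


theorem theorem20:
  fixes f :: "real \<Rightarrow> real" and N K :: nat and \<S> :: "nat \<Rightarrow> nat list list"
  assumes "1 \<le> N" and "2 \<le> K" and "nested_family K \<S>"
  shows
    "(\<forall>s\<in>multi_indices K.
        let k = safe_level K \<S> s;
            x_le = dyadic_value (take k s);
            x_gt = (\<Sum>l = k + 1..K. real (s ! (l - 1)) / 2 ^ l)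
        in (k \<le> K - 1 \<longrightarrow>
              multires_qtt f N K \<S> s =
                (\<Sum>a = 0..N. f (x_le + cl_node N a / 2 ^ k) * poly (cl_basis N a) (2 ^ k * x_gt)) \<and>
              multires_qtt f N K \<S> s = poly (cl_interpolant f N x_le k) (dyadic_value s)) \<and>
           (k = K \<longrightarrow> multires_qtt f N K \<S> s = f (dyadic_value s))) \<and>
     ereal (tensor_norm K (\<lambda>s. multires_qtt f N K \<S> s - qtensor f s)) \<le>
       max_or_zero {cl_error f N x k | x k.
         k \<in> {1..K - 1} \<and> x \<in> dyadic_grid k \<and>
         {x .. x + 1 / 2 ^ k} \<notin> (\<Union>j\<in>{1..K - 1}. dyadic_interval ` set (\<S> j))}"
proof (intro conjI ballI)
  note N = assms(1) and K = assms(2) and nest = assms(3)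
  have formula: "multires_qtt f N K \<S> s =
      (\<Sum>a = 0..N. f (dyadic_value (take k s) + cl_node N a / 2 ^ k) *
         poly (cl_basis N a) (dyadic_value (drop k s)))"
    if s: "s \<in> multi_indices K" and k: "k = safe_level K \<S> s" "k < K" for s k
  proof -
    have "k \<le> length s" using s k(2) by (simp add: multi_indices_def)
    then have split: "dyadic_value s = dyadic_value (take k s) + dyadic_value (drop k s) / 2 ^ k"
      by (rule dyadic_value_split)
    show ?thesis
      unfolding multires_qtt_interpolant[OF N nest s k] split by (rule cl_interpolant_lagrange[OF N])
  qed
  {
    fix s assume s: "s \<in> multi_indices K"
    define k where "k = safe_level K \<S> s"
    have len: "length s = K" using s by (simp add: multi_indices_def)
    have k_le: "k \<le> K" using safe_level_props(1)[OF nest, of s] K k_def by auto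
    show "let k = safe_level K \<S> s;
            x_le = dyadic_value (take k s);
            x_gt = (\<Sum>l = k + 1..K. real (s ! (l - 1)) / 2 ^ l)
        in (k \<le> K - 1 \<longrightarrow>
              multires_qtt f N K \<S> s =
                (\<Sum>a = 0..N. f (x_le + cl_node N a / 2 ^ k) * poly (cl_basis N a) (2 ^ k * x_gt)) \<and>
              multires_qtt f N K \<S> s = poly (cl_interpolant f N x_le k) (dyadic_value s)) \<and>
           (k = K \<longrightarrow> multires_qtt f N K \<S> s = f (dyadic_value s))"
      unfolding Let_def k_def[symmetric] dyadic_value_fine_part[OF len k_le]
      using formula[OF s k_def] multires_qtt_interpolant[OF N nest s k_def]
        multires_qtt_exact[OF K nest s] K
      by (auto simp: k_def)
  }
  let ?E = "{cl_error f N x k | x k.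
         k \<in> {1..K - 1} \<and> x \<in> dyadic_grid k \<and>
         {x .. x + 1 / 2 ^ k} \<notin> (\<Union>j\<in>{1..K - 1}. dyadic_interval ` set (\<S> j))}"
  have "finite ((\<lambda>(k, x). cl_error f N x k) ` (SIGMA k:{1..K - 1}. dyadic_grid k))"
    by (intro finite_imageI finite_SigmaI finite_dyadic_grid) auto
  then have fin: "finite ?E"
    by (rule rev_finite_subset) force
  have upper: "e \<le> max_or_zero ?E" if "e \<in> ?E" for e
  proof -
    have "?E \<noteq> {}" using that by blast
    then show ?thesis using Max_ge[OF fin that] by (simp only: max_or_zero_def if_False)
  qed
  have nonneg: "0 \<le> max_or_zero ?E"
  proof (cases "?E = {}")
    case False
    then obtain e where e: "e \<in> ?E" by blast
    then have "0 \<le> e" using cl_error_nonneg by auto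
    then show ?thesis using upper[OF e] by (rule order_trans)
  qed (simp add: max_or_zero_def)
  define S where "S = (\<lambda>s. multires_qtt f N K \<S> s - qtensor f s)"
  have "tensor_norm K S \<in> (\<lambda>s. \<bar>S s\<bar>) ` multi_indices K"
    unfolding tensor_norm_def
    by (rule Max_in) (use finite_multi_indices multi_indices_nonempty in auto)
  then obtain s where s: "s \<in> multi_indices K" and norm: "tensor_norm K S = \<bar>S s\<bar>" by auto
  define k where "k = safe_level K \<S> s"
  have k: "1 \<le> k" "k \<le> K" "take k s \<notin> set (\<S> k)"
    using safe_level_props(1,2)[OF nest, of s] K k_def by auto
  have "ereal \<bar>S s\<bar> \<le> max_or_zero ?E"
  proof (cases "k = K")
    case True
    then have "S s = 0"
      using multires_qtt_exact[OF K nest s] by (simp add: S_def qtensor_def k_def)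
    then show ?thesis using nonneg by (simp add: zero_ereal_def)
  next
    case False
    then have kK: "k < K" using k by simp
    let ?x = "dyadic_value (take k s)" and ?v = "dyadic_value (drop k s)"
    have len: "length s = K" and bits: "set s \<subseteq> {0, 1}"
      using s by (auto simp: multi_indices_def)
    have t: "take k s \<in> multi_indices k" by (rule take_in_multi_indices[OF s k(2)])
    have "{?x .. ?x + 1 / 2 ^ k} \<notin> (\<Union>j\<in>{1..K - 1}. dyadic_interval ` set (\<S> j))"
    proof
      assume "{?x .. ?x + 1 / 2 ^ k} \<in> (\<Union>j\<in>{1..K - 1}. dyadic_interval ` set (\<S> j))"
      then obtain j u where j: "j \<in> {1..K - 1}" and u: "u \<in> set (\<S> j)"
        and "{?x .. ?x + 1 / 2 ^ k} = dyadic_interval u" by auto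
      moreover have "dyadic_interval (take k s) = {?x .. ?x + 1 / 2 ^ k}"
        using len k(2) by (simp add: dyadic_interval_def)
      ultimately have eq: "dyadic_interval (take k s) = dyadic_interval u" by simp
      have "u \<in> multi_indices j"
        using nested_familyD(2)[OF nest, of j] j u by (auto simp: subset_iff)
      then show False using dyadic_interval_inj[OF t _ eq] u k(3) by auto
    qed
    moreover have "k \<in> {1..K - 1}" using k(1) kK by auto
    ultimately have "cl_error f N ?x k \<in> ?E"
      using dyadic_value_in_grid[OF t] by (intro CollectI exI[of _ ?x] exI[of _ k] conjI refl)
    then have "cl_error f N ?x k \<le> max_or_zero ?E" by (rule upper)
    moreover have "ereal \<bar>S s\<bar> \<le> cl_error f N ?x k"
    proof -
      have "set (drop k s) \<subseteq> {0, 1}" by (rule order_trans[OF set_drop_subset bits])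
      then have v: "0 \<le> ?v" "?v \<le> 1" using dyadic_value_bounds[of "drop k s"] by auto
      have "f (dyadic_value s) = f (?x + ?v / 2 ^ k)"
        using dyadic_value_split[of k s] len k(2) by simp
      then have "\<bar>S s\<bar> = \<bar>f (?x + ?v / 2 ^ k)
          - (\<Sum>a = 0..N. f (?x + cl_node N a / 2 ^ k) * poly (cl_basis N a) ?v)\<bar>"
        unfolding S_def qtensor_def formula[OF s k_def kK] by (simp add: abs_minus_commute)
      then show ?thesis using cl_error_upper[OF v, of f ?x k N] by simp
    qed
    ultimately show ?thesis by (rule order_trans[rotated])
  qed
  then show "ereal (tensor_norm K (\<lambda>s. multires_qtt f N K \<S> s - qtensor f s)) \<le> max_or_zero ?E"
    using norm unfolding S_def by simp
qed

end
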